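(* Let $\mathcal{L}_1,\mathcal{L}_2,\mathcal{L}_3$ be finite non-empty sets of lines in $\mathbb{R}^3$. Call a point $x$ a joint if there are $l_1\in\mathcal{L}_1$, $l_2\in\mathcal{L}_2$, $l_3\in\mathcal{L}_3$ all passing through $x$ and not coplanar. Then for every $\epsilon>0$ there is a constant $C$ (depending only on $\epsilon$) such that the number of joints is at most $C|\mathcal{L}_1|^{1/2+\epsilon}|\mathcal{L}_2|^{1/2+\epsilon}|\mathcal{L}_3|^{1/2+\epsilon}$. In particular, if $|\mathcal{L}_1|=|\mathcal{L}_2|=|\mathcal{L}_3|=N$, the number of joints is at most $CN^{3/2+3\epsilon}$. *)

theory Defs
  imports "HOL-Analysis.Analysis"
begin

definition is_line :: "(real ^ 3) set \<Rightarrow> bool" where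
  "is_line l \<longleftrightarrow> affine l \<and> aff_dim l = 1"

definition joints ::
  "(real ^ 3) set set \<Rightarrow> (real ^ 3) set set \<Rightarrow> (real ^ 3) set set \<Rightarrow> (real ^ 3) set" where
  "joints L1 L2 L3 =
     {x. \<exists>l1\<in>L1. \<exists>l2\<in>L2. \<exists>l3\<in>L3. x \<in> l1 \<and> x \<in> l2 \<and> x \<in> l3 \<and> \<not> coplanar (l1 \<union> l2 \<union> l3)}"

end

theory Submission
  imports Defs "HOL-Computational_Algebra.Polynomial"
begin

text \<open>
  Choose three non-coplanar lines through every joint, and let \<open>m\<^sub>i p\<close> be the number of joints
  that share the \<open>i\<close>-th line of \<open>p\<close>. A polynomial of degree at most \<open>n\<close> is zero as soon as, at every
  joint \<open>p\<close>, its Taylor coefficients \<open>(i, j, k)\<close> along the three lines vanish for \<open>i \<le> n / m\<^sub>1 p\<close>,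
  \<open>j \<le> n / m\<^sub>2 p\<close>, \<open>k \<le> n / m\<^sub>3 p\<close>: inductively, suppose that it vanishes to order \<open>i + j + k\<close> at all
  joints and that, say, \<open>i * m\<^sub>1 p > n\<close>. Then the transversal derivative of type \<open>(j, k)\<close>, restricted
  to the first line of \<open>p\<close>, has \<open>m\<^sub>1 p\<close> zeros of order \<open>i\<close>, so it is zero. Counting dimensions,
  \<open>\<Sum>p. 1 / (m\<^sub>1 p * m\<^sub>2 p * m\<^sub>3 p)\<close> is bounded below by an absolute constant. After discarding
  the joints on poor lines, \<open>m\<^sub>i p\<close> is at least the number of joints divided by \<open>6 * card L\<^sub>i\<close>, and the
  bound follows even without the \<open>\<epsilon>\<close>-loss.
\<close>

section \<open>Trivariate polynomials with bounds on total degree\<close>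

definition trivariate ::
    "nat \<Rightarrow> (nat \<Rightarrow> nat \<Rightarrow> nat \<Rightarrow> real) \<Rightarrow> real \<Rightarrow> real \<Rightarrow> real \<Rightarrow> real" where
  "trivariate n c s t u = (\<Sum>i\<le>n. \<Sum>j\<le>n. \<Sum>k\<le>n. c i j k * s ^ i * t ^ j * u ^ k)"

text \<open>The bound \<open>a\<close> encodes vanishing to order \<open>a\<close> at the origin,
  and \<open>n\<close> bounds the total degree. For \<open>a > n\<close> only the zero array
  qualifies; the final contradiction comes from this case.\<close>

definition coeffs_between :: "nat \<Rightarrow> nat \<Rightarrow> (nat \<Rightarrow> nat \<Rightarrow> nat \<Rightarrow> real) \<Rightarrow> bool" where
  "coeffs_between a n c \<longleftrightarrow> (\<forall>i j k. c i j k \<noteq> 0 \<longrightarrow> a \<le> i + j + k \<and> i + j + k \<le> n)"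

text \<open>A property of functions rather than of coefficient arrays, so that changes of variables
  can be written as plain function terms; the array is recovered by
  \<open>trivariate_inject\<close>.\<close>

definition tpoly :: "nat \<Rightarrow> nat \<Rightarrow> (real \<Rightarrow> real \<Rightarrow> real \<Rightarrow> real) \<Rightarrow> bool" where
  "tpoly a n g \<longleftrightarrow> (\<exists>c. coeffs_between a n c \<and> g = trivariate n c)"

lemma coeffs_betweenD:
  "coeffs_between a n c \<Longrightarrow> i + j + k < a \<or> n < i + j + k \<Longrightarrow> c i j k = 0"
  unfolding coeffs_between_def by (meson leD)

lemma trivariate_swap_sums:
  "trivariate n c s t u = (\<Sum>j\<le>n. \<Sum>k\<le>n. (\<Sum>i\<le>n. c i j k * s ^ i) * t ^ j * u ^ k)"
proof -
  have "trivariate n c s t u = (\<Sum>j\<le>n. \<Sum>i\<le>n. \<Sum>k\<le>n. c i j k * s ^ i * t ^ j * u ^ k)"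
    unfolding trivariate_def by (rule sum.swap)
  also have "\<dots> = (\<Sum>j\<le>n. \<Sum>k\<le>n. \<Sum>i\<le>n. c i j k * s ^ i * t ^ j * u ^ k)"
    by (intro sum.cong refl sum.swap)
  finally show ?thesis by (simp add: sum_distrib_right)
qed

text \<open>Permits an argument about the first variable to be reused for the other two.\<close>

lemma trivariate_rotate: "trivariate n (\<lambda>j k i. c i j k) t u s = trivariate n c s t u"
  by (subst (2) trivariate_swap_sums) (simp add: trivariate_def sum_distrib_right sum_distrib_left mult_ac)

lemma trivariate_add:
  "trivariate n (\<lambda>i j k. c i j k + d i j k) s t u = trivariate n c s t u + trivariate n d s t u"
  by (simp add: trivariate_def distrib_right sum.distrib)

lemma trivariate_scale:
  "trivariate n (\<lambda>i j k. x * c i j k) s t u = x * trivariate n c s t u"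
  by (simp add: trivariate_def sum_distrib_left mult.assoc)

lemma trivariate_sum:
  assumes "finite B"
  shows "trivariate n (\<lambda>i j k. \<Sum>m\<in>B. c m * e m i j k) s t u =
    (\<Sum>m\<in>B. c m * trivariate n (e m) s t u)"
  using assms
proof (induction B rule: finite_induct)
  case empty
  then show ?case by (simp add: trivariate_def)
next
  case (insert m B)
  then show ?case by (simp add: trivariate_add trivariate_scale)
qed

lemma bivariate_eq_zeroD:
  fixes c :: "nat \<Rightarrow> nat \<Rightarrow> real"
  assumes "\<And>t u. (\<Sum>j\<le>n. \<Sum>k\<le>n. c j k * t ^ j * u ^ k) = 0" "j \<le> n" "k \<le> n"
  shows "c j k = 0"
proof (rule zero_polynom_imp_zero_coeffs[OF _ \<open>k \<le> n\<close>])
  fix u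
  show "(\<Sum>k\<le>n. c j k * u ^ k) = 0"
  proof (rule zero_polynom_imp_zero_coeffs[OF _ \<open>j \<le> n\<close>])
    fix t
    show "(\<Sum>j\<le>n. (\<Sum>k\<le>n. c j k * u ^ k) * t ^ j) = 0"
      using assms(1)[of t u] by (simp add: sum_distrib_right sum_distrib_left mult_ac)
  qed
qed

text \<open>Since \<open>s\<close> and \<open>s'\<close> are fixed and may differ, this compares
  expansions of one function around two different points of the first axis, with \<open>t\<close>
  and \<open>u\<close> unchanged.\<close>

lemma trivariate_eq_slice:
  assumes "\<And>t u. trivariate n c s t u = trivariate n d s' t u" "j \<le> n" "k \<le> n"
  shows "(\<Sum>i\<le>n. c i j k * s ^ i) = (\<Sum>i\<le>n. d i j k * s' ^ i)"
proof -
  let ?e = "\<lambda>j k. (\<Sum>i\<le>n. c i j k * s ^ i) - (\<Sum>i\<le>n. d i j k * s' ^ i)"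
  have "?e j k = 0"
  proof (rule bivariate_eq_zeroD[OF _ assms(2,3)])
    fix t u
    show "(\<Sum>j\<le>n. \<Sum>k\<le>n. ?e j k * t ^ j * u ^ k) = 0"
      using assms(1)[of t u] by (simp add: trivariate_swap_sums left_diff_distrib sum_subtractf)
  qed
  then show ?thesis by simp
qed

text \<open>Inside the cube of exponents, slices reduce the claim to one variable. The sum in
  \<open>trivariate\<close> cannot see entries outside that cube; the degree bounds make those
  zero.\<close>

lemma trivariate_inject:
  assumes c: "coeffs_between 0 n c" and d: "coeffs_between 0 n d"
    and eq: "trivariate n c = trivariate n d"
  shows "c = d"
proof (intro ext)
  fix i j k
  show "c i j k = d i j k"
  proof (cases "i + j + k \<le> n")
    case True
    have "c i j k - d i j k = 0"
    proof (rule zero_polynom_imp_zero_coeffs[of "\<lambda>i. c i j k - d i j k" n])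
      fix s
      have "(\<Sum>i\<le>n. c i j k * s ^ i) = (\<Sum>i\<le>n. d i j k * s ^ i)"
        by (rule trivariate_eq_slice) (use eq True in auto)
      then show "(\<Sum>i\<le>n. (c i j k - d i j k) * s ^ i) = 0"
        by (simp add: left_diff_distrib sum_subtractf)
    qed (use True in simp)
    then show ?thesis by simp
  next
    case False
    then show ?thesis using coeffs_betweenD[OF c] coeffs_betweenD[OF d] by simp
  qed
qed

lemma coeffs_between_mono: "coeffs_between a n c \<Longrightarrow> b \<le> a \<Longrightarrow> n \<le> m \<Longrightarrow> coeffs_between b m c"
  unfolding coeffs_between_def by (meson order_trans)

lemma tpoly_zero: "tpoly a n (\<lambda>s t u. 0)"
  unfolding tpoly_def
  by (rule exI[of _ "\<lambda>i j k. 0"]) (auto simp: coeffs_between_def trivariate_def fun_eq_iff)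

lemma tpoly_monomial:
  assumes "a \<le> i + j + k" "i + j + k \<le> n"
  shows "tpoly a n (\<lambda>s t u. s ^ i * t ^ j * u ^ k)"
proof -
  define c :: "nat \<Rightarrow> nat \<Rightarrow> nat \<Rightarrow> real" where
    "c = (\<lambda>i' j' k'. if k' = k then if j' = j then if i' = i then 1 else 0 else 0 else 0)"
  have "trivariate n c s t u = s ^ i * t ^ j * u ^ k" for s t u
  proof -
    have "trivariate n c s t u = (\<Sum>i'\<le>n. \<Sum>j'\<le>n. \<Sum>k'\<le>n.
        if k' = k then if j' = j then if i' = i then s ^ i * t ^ j * u ^ k else 0 else 0 else 0)"
      unfolding trivariate_def c_def by (intro sum.cong refl) auto
    also have "\<dots> = s ^ i * t ^ j * u ^ k"
      using assms by simp
    finally show ?thesis .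
  qed
  moreover have "coeffs_between a n c"
    using assms by (auto simp: coeffs_between_def c_def)
  ultimately show ?thesis unfolding tpoly_def by (intro exI[of _ c]) (auto simp: fun_eq_iff)
qed

lemma tpoly_add:
  assumes "tpoly a n f" "tpoly a n g"
  shows "tpoly a n (\<lambda>s t u. f s t u + g s t u)"
proof -
  obtain c d where "coeffs_between a n c" "f = trivariate n c" "coeffs_between a n d" "g = trivariate n d"
    using assms unfolding tpoly_def by blast
  then show ?thesis unfolding tpoly_def
    by (intro exI[of _ "\<lambda>i j k. c i j k + d i j k"])
      (auto simp: coeffs_between_def trivariate_add fun_eq_iff, (metis add_0_left)+)
qed

lemma tpoly_scale:
  assumes "tpoly a n f"
  shows "tpoly a n (\<lambda>s t u. x * f s t u)"
proof -
  obtain c where "coeffs_between a n c" "f = trivariate n c"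
    using assms unfolding tpoly_def by blast
  then show ?thesis unfolding tpoly_def
    by (intro exI[of _ "\<lambda>i j k. x * c i j k"])
      (auto simp: coeffs_between_def trivariate_scale fun_eq_iff)
qed

lemma tpoly_sum:
  assumes "finite I" "\<And>i. i \<in> I \<Longrightarrow> tpoly a n (f i)"
  shows "tpoly a n (\<lambda>s t u. \<Sum>i\<in>I. f i s t u)"
  using assms by (induction I rule: finite_induct) (auto intro: tpoly_zero tpoly_add)

section \<open>Substitution into polynomials\<close>

text \<open>By linearity only monomials need checking. The factor \<open>h\<close> lets one lemma
  serve both multiplication and, with \<open>h = 1\<close>, pure substitution; nesting the product
  to the right matches repeated multiplication by powers.\<close>

lemma tpoly_substitute:
  assumes g: "tpoly a n g"
    and mono: "\<And>i j k. a \<le> i + j + k \<Longrightarrow> i + j + k \<le> n \<Longrightarrow>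
      tpoly b m (\<lambda>s t u. X s t u ^ i * (Y s t u ^ j * (Z s t u ^ k * h s t u)))"
  shows "tpoly b m (\<lambda>s t u. g (X s t u) (Y s t u) (Z s t u) * h s t u)"
proof -
  obtain c where c: "coeffs_between a n c" "g = trivariate n c"
    using g unfolding tpoly_def by blast
  have monomial: "tpoly b m (\<lambda>s t u. c i j k * (X s t u ^ i * (Y s t u ^ j * (Z s t u ^ k * h s t u))))" for i j k
  proof (cases "c i j k = 0")
    case True
    then show ?thesis by (simp add: tpoly_zero)
  next
    case False
    then show ?thesis using c(1) by (intro tpoly_scale mono) (auto simp: coeffs_between_def)
  qed
  have "tpoly b m (\<lambda>s t u. \<Sum>i\<le>n. \<Sum>j\<le>n. \<Sum>k\<le>n.
      c i j k * (X s t u ^ i * (Y s t u ^ j * (Z s t u ^ k * h s t u))))"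
    by (intro tpoly_sum monomial) auto
  then show ?thesis by (simp add: c(2) trivariate_def sum_distrib_right sum_distrib_left mult_ac)
qed

lemma tpoly_mono:
  assumes "tpoly a n g" "b \<le> a" "n \<le> m"
  shows "tpoly b m g"
proof -
  have "tpoly b m (\<lambda>s t u. g s t u * 1)"
    by (rule tpoly_substitute[OF assms(1)]) (use assms tpoly_monomial in \<open>auto simp: mult.assoc\<close>)
  then show ?thesis by simp
qed

lemma tpoly_mult_linear:
  assumes g: "tpoly a n g"
  shows "tpoly (Suc a) (Suc n) (\<lambda>s t u. (\<alpha> * s + \<beta> * t + \<gamma> * u) * g s t u)"
proof -
  have 1: "tpoly (Suc a) (Suc n) (\<lambda>s t u. g s t u * s)"
  proof (rule tpoly_substitute[OF g])
    fix i j k assume "a \<le> i + j + k" "i + j + k \<le> n"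
    then have "tpoly (Suc a) (Suc n) (\<lambda>s t u. s ^ Suc i * t ^ j * u ^ k)"
      by (intro tpoly_monomial) auto
    then show "tpoly (Suc a) (Suc n) (\<lambda>s t u. s ^ i * (t ^ j * (u ^ k * s)))"
      by (simp add: mult_ac)
  qed
  have 2: "tpoly (Suc a) (Suc n) (\<lambda>s t u. g s t u * t)"
  proof (rule tpoly_substitute[OF g])
    fix i j k assume "a \<le> i + j + k" "i + j + k \<le> n"
    then have "tpoly (Suc a) (Suc n) (\<lambda>s t u. s ^ i * t ^ Suc j * u ^ k)"
      by (intro tpoly_monomial) auto
    then show "tpoly (Suc a) (Suc n) (\<lambda>s t u. s ^ i * (t ^ j * (u ^ k * t)))"
      by (simp add: mult_ac)
  qed
  have 3: "tpoly (Suc a) (Suc n) (\<lambda>s t u. g s t u * u)"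
  proof (rule tpoly_substitute[OF g])
    fix i j k assume "a \<le> i + j + k" "i + j + k \<le> n"
    then have "tpoly (Suc a) (Suc n) (\<lambda>s t u. s ^ i * t ^ j * u ^ Suc k)"
      by (intro tpoly_monomial) auto
    then show "tpoly (Suc a) (Suc n) (\<lambda>s t u. s ^ i * (t ^ j * (u ^ k * u)))"
      by (simp add: mult_ac)
  qed
  have "tpoly (Suc a) (Suc n) (\<lambda>s t u. \<alpha> * (g s t u * s) + \<beta> * (g s t u * t) + \<gamma> * (g s t u * u))"
    by (intro tpoly_add tpoly_scale 1 2 3)
  then show ?thesis by (simp add: algebra_simps)
qed

lemma tpoly_mult_linear_power:
  assumes "tpoly a n g"
  shows "tpoly (i + a) (i + n) (\<lambda>s t u. (\<alpha> * s + \<beta> * t + \<gamma> * u) ^ i * g s t u)"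
  using assms
  by (induction i) (auto simp: mult.assoc dest: tpoly_mult_linear[where \<alpha>=\<alpha> and \<beta>=\<beta> and \<gamma>=\<gamma>])

lemma tpoly_mult_affine_power:
  assumes "tpoly 0 n g"
  shows "tpoly 0 (i + n) (\<lambda>s t u. (\<delta> + (\<alpha> * s + \<beta> * t + \<gamma> * u)) ^ i * g s t u)"
proof (induction i)
  case 0
  then show ?case using assms by simp
next
  case (Suc i)
  let ?h = "\<lambda>s t u. (\<delta> + (\<alpha> * s + \<beta> * t + \<gamma> * u)) ^ i * g s t u"
  have "tpoly 0 (Suc (i + n)) (\<lambda>s t u. \<delta> * ?h s t u + (\<alpha> * s + \<beta> * t + \<gamma> * u) * ?h s t u)"
    by (intro tpoly_add tpoly_scale tpoly_mono[OF Suc.IH] tpoly_mono[OF tpoly_mult_linear[OF Suc.IH]]) auto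
  then show ?case by (simp add: distrib_right mult.assoc)
qed

lemma tpoly_one: "tpoly 0 0 (\<lambda>s t u. 1)"
  using tpoly_monomial[of 0 0 0 0 0] by simp

text \<open>Linear forms have no constant term, so a product of \<open>i + j + k\<close> of them
  keeps order \<open>i + j + k\<close>. Constant terms destroy this, hence the affine version below
  starts and ends with order 0.\<close>

lemma tpoly_linear_substitution:
  assumes "tpoly a n g"
  shows "tpoly a n (\<lambda>s t u. g (\<alpha>1 * s + \<beta>1 * t + \<gamma>1 * u) (\<alpha>2 * s + \<beta>2 * t + \<gamma>2 * u) (\<alpha>3 * s + \<beta>3 * t + \<gamma>3 * u))"
proof -
  have "tpoly a n (\<lambda>s t u. g (\<alpha>1 * s + \<beta>1 * t + \<gamma>1 * u) (\<alpha>2 * s + \<beta>2 * t + \<gamma>2 * u) (\<alpha>3 * s + \<beta>3 * t + \<gamma>3 * u) * 1)"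
  proof (rule tpoly_substitute[OF assms])
    fix i j k assume *: "a \<le> i + j + k" "i + j + k \<le> n"
    show "tpoly a n (\<lambda>s t u. (\<alpha>1 * s + \<beta>1 * t + \<gamma>1 * u) ^ i * ((\<alpha>2 * s + \<beta>2 * t + \<gamma>2 * u) ^ j *
        ((\<alpha>3 * s + \<beta>3 * t + \<gamma>3 * u) ^ k * 1)))"
      by (rule tpoly_mono, (rule tpoly_mult_linear_power)+, rule tpoly_one) (use * in auto)
  qed
  then show ?thesis by simp
qed

lemma tpoly_affine_substitution:
  assumes "tpoly 0 n g"
  shows "tpoly 0 n (\<lambda>s t u. g (\<delta>1 + (\<alpha>1 * s + \<beta>1 * t + \<gamma>1 * u)) (\<delta>2 + (\<alpha>2 * s + \<beta>2 * t + \<gamma>2 * u))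
    (\<delta>3 + (\<alpha>3 * s + \<beta>3 * t + \<gamma>3 * u)))"
proof -
  have "tpoly 0 n (\<lambda>s t u. g (\<delta>1 + (\<alpha>1 * s + \<beta>1 * t + \<gamma>1 * u)) (\<delta>2 + (\<alpha>2 * s + \<beta>2 * t + \<gamma>2 * u))
    (\<delta>3 + (\<alpha>3 * s + \<beta>3 * t + \<gamma>3 * u)) * 1)"
  proof (rule tpoly_substitute[OF assms])
    fix i j k assume *: "0 \<le> i + j + k" "i + j + k \<le> n"
    show "tpoly 0 n (\<lambda>s t u. (\<delta>1 + (\<alpha>1 * s + \<beta>1 * t + \<gamma>1 * u)) ^ i * ((\<delta>2 + (\<alpha>2 * s + \<beta>2 * t + \<gamma>2 * u)) ^ j *
        ((\<delta>3 + (\<alpha>3 * s + \<beta>3 * t + \<gamma>3 * u)) ^ k * 1)))"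
      by (rule tpoly_mono, (rule tpoly_mult_affine_power)+, rule tpoly_one) (use * in auto)
  qed
  then show ?thesis by simp
qed

section \<open>Underdetermined linear systems\<close>

text \<open>Gaussian elimination by induction on the equations: an equation \<open>t0\<close> with a
  nonzero entry at \<open>s0\<close> is used to eliminate the unknown \<open>s0\<close> from all
  others, which leaves one equation and one unknown fewer.\<close>

lemma homogeneous_system_nontrivial:
  fixes A :: "'t \<Rightarrow> 's \<Rightarrow> real"
  assumes "finite T" "finite S" "card T < card S"
  shows "\<exists>c. (\<exists>s\<in>S. c s \<noteq> 0) \<and> (\<forall>t\<in>T. (\<Sum>s\<in>S. A t s * c s) = 0)"
  using assms
proof (induction T arbitrary: S A rule: finite_induct)
  case empty
  then have "S \<noteq> {}" by auto
  then show ?case by (intro exI[of _ "\<lambda>s. 1"]) auto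
next
  case (insert t0 T)
  show ?case
  proof (cases "\<forall>s\<in>S. A t0 s = 0")
    case True
    have "card T < card S" using insert by simp
    from insert.IH[OF insert.prems(1) this, of A] obtain c where
      "\<exists>s\<in>S. c s \<noteq> 0" "\<forall>t\<in>T. (\<Sum>s\<in>S. A t s * c s) = 0" by blast
    with True show ?thesis by (intro exI[of _ c]) auto
  next
    case False
    then obtain s0 where s0: "s0 \<in> S" "A t0 s0 \<noteq> 0" by blast
    let ?S = "S - {s0}"
    have "card T < card ?S" using insert s0 by (simp add: card_Diff_singleton)
    from insert.IH[OF _ this, of "\<lambda>t s. A t s - A t s0 / A t0 s0 * A t0 s"] insert.prems
    obtain c where c: "\<exists>s\<in>?S. c s \<noteq> 0"
      "\<And>t. t \<in> T \<Longrightarrow> (\<Sum>s\<in>?S. (A t s - A t s0 / A t0 s0 * A t0 s) * c s) = 0" by auto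
    \<comment> \<open>Back substitution: the value of the unknown \<open>s0\<close> that solves
      equation \<open>t0\<close>.\<close>
    define w where "w = - (\<Sum>s\<in>?S. A t0 s * c s) / A t0 s0"
    have split: "(\<Sum>s\<in>S. A t s * (c(s0 := w)) s) = A t s0 * w + (\<Sum>s\<in>?S. A t s * c s)" for t
    proof -
      have "(\<Sum>s\<in>S. A t s * (c(s0 := w)) s) = A t s0 * w + (\<Sum>s\<in>?S. A t s * (c(s0 := w)) s)"
        using s0 insert.prems by (subst sum.remove[of S s0]) auto
      also have "(\<Sum>s\<in>?S. A t s * (c(s0 := w)) s) = (\<Sum>s\<in>?S. A t s * c s)"
        by (intro sum.cong) auto
      finally show ?thesis .
    qed
    have "(\<Sum>s\<in>S. A t s * (c(s0 := w)) s) = 0" if "t \<in> insert t0 T" for t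
    proof (cases "t = t0")
      case True
      then show ?thesis unfolding split using s0 by (simp add: w_def)
    next
      case False
      with that have "(\<Sum>s\<in>?S. (A t s - A t s0 / A t0 s0 * A t0 s) * c s) = 0" using c(2) by auto
      then have "(\<Sum>s\<in>?S. A t s * c s) = A t s0 / A t0 s0 * (\<Sum>s\<in>?S. A t0 s * c s)"
        by (simp add: left_diff_distrib sum_subtractf sum_distrib_left mult.assoc)
      then show ?thesis unfolding split by (simp add: w_def)
    qed
    then show ?thesis using c(1) by (intro exI[of _ "c(s0 := w)"]) auto
  qed
qed

section \<open>Counting zeros along a line\<close>

text \<open>The coefficient of \<open>t ^ j * u ^ k\<close> is a polynomial \<open>P\<close> in
  \<open>s\<close> of degree at most \<open>n\<close>. Order \<open>i + j + k\<close> at a point of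
  the axis leaves order at least \<open>i\<close> for \<open>P\<close>, so \<open>P\<close> has more
  zeros than its degree allows unless it is zero.\<close>

lemma coeff_zero_of_vanishing_along_axis:
  assumes Q: "finite Q" "n < card Q * i" and i: "i \<le> n" and jk: "j \<le> n" "k \<le> n"
    and van: "\<And>\<sigma>. \<sigma> \<in> Q \<Longrightarrow> tpoly (i + j + k) n (\<lambda>s t u. trivariate n c (\<sigma> + s) t u)"
  shows "c i j k = 0"
proof -
  define P where "P = (\<Sum>a\<le>n. monom (c a j k) a)"
  have polyP: "poly P x = (\<Sum>a\<le>n. c a j k * x ^ a)" for x
    by (simp add: P_def poly_sum poly_monom)
  have degP: "degree P \<le> n"
    unfolding P_def by (intro degree_sum_le) (auto intro: order_trans[OF degree_monom_le])
  have "P = 0"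
  proof (rule ccontr)
    assume "P \<noteq> 0"
    have ord: "i \<le> order \<sigma> P" if \<sigma>: "\<sigma> \<in> Q" for \<sigma>
    proof -
      obtain d where d: "coeffs_between (i + j + k) n d"
        "(\<lambda>s t u. trivariate n c (\<sigma> + s) t u) = trivariate n d"
        using van[OF \<sigma>] unfolding tpoly_def by blast
      \<comment> \<open>The expansion of \<open>P\<close> around \<sigma> with the factor
        \<open>(x - \<sigma>) ^ i\<close> divided out.\<close>
      define R where "R = (\<Sum>a\<in>{i..n}. monom (d a j k) (a - i))"
      have "poly P x = poly ([:-\<sigma>, 1:] ^ i * pcompose R [:-\<sigma>, 1:]) x" for x
      proof -
        have "poly P x = (\<Sum>a\<le>n. c a j k * (\<sigma> + (x - \<sigma>)) ^ a)" by (simp add: polyP)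
        also have "\<dots> = (\<Sum>a\<le>n. d a j k * (x - \<sigma>) ^ a)"
          by (rule trivariate_eq_slice[OF _ jk]) (use d(2) in metis)
        \<comment> \<open>Terms with \<open>a < i\<close> have total degree below
          \<open>i + j + k\<close>, so their coefficients are zero.\<close>
        also have "\<dots> = (\<Sum>a\<in>{i..n}. d a j k * (x - \<sigma>) ^ a)"
          using coeffs_betweenD[OF d(1)] by (intro sum.mono_neutral_right) auto
        also have "\<dots> = (\<Sum>a\<in>{i..n}. (x - \<sigma>) ^ i * (d a j k * (x - \<sigma>) ^ (a - i)))"
          by (intro sum.cong refl) (simp add: power_add[symmetric])
        also have "\<dots> = poly ([:-\<sigma>, 1:] ^ i * pcompose R [:-\<sigma>, 1:]) x"
          by (simp add: R_def poly_pcompose poly_sum poly_monom sum_distrib_left)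
        finally show ?thesis .
      qed
      then have "P = [:-\<sigma>, 1:] ^ i * pcompose R [:-\<sigma>, 1:]" by (simp add: poly_eq_poly_eq_iff[symmetric] fun_eq_iff)
      then have "[:-\<sigma>, 1:] ^ i dvd P" by simp
      then show ?thesis using \<open>P \<noteq> 0\<close> by (simp add: order_divides)
    qed
    have "card Q * i \<le> degree P"
    proof (cases "i = 0")
      case False
      have "card Q * i = (\<Sum>\<sigma>\<in>Q. i)" by simp
      also have "\<dots> \<le> (\<Sum>\<sigma>\<in>Q. order \<sigma> P)" by (intro sum_mono ord)
      \<comment> \<open>As \<open>i\<close> is positive, every element of \<open>Q\<close> is a root
        of \<open>P\<close>.\<close>
      also have "\<dots> \<le> (\<Sum>\<sigma> | poly P \<sigma> = 0. order \<sigma> P)"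
        using ord False \<open>P \<noteq> 0\<close>
        by (intro sum_mono2 poly_roots_finite) (auto simp: order_root intro: less_le_trans)
      also have "\<dots> \<le> degree P" by (rule sum_order_le_degree[OF \<open>P \<noteq> 0\<close>])
      finally show ?thesis .
    qed simp
    with degP Q(2) show False by simp
  qed
  then have "coeff P i = 0" by simp
  then show ?thesis using i by (simp add: P_def coeff_sum)
qed

section \<open>Order of vanishing at points of space\<close>

text \<open>\<open>f\<close> is a polynomial of degree at most \<open>n\<close> vanishing to order \<open>r\<close> at \<open>p\<close>. Quantifying over all
  triples \<open>v w z\<close>, independent or not, makes this independent of the lines through \<open>p\<close>.\<close>

definition vanishes :: "nat \<Rightarrow> nat \<Rightarrow> (real ^ 3 \<Rightarrow> real) \<Rightarrow> real ^ 3 \<Rightarrow> bool" where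
  "vanishes n r f p \<longleftrightarrow>
     (\<forall>v w z. tpoly r n (\<lambda>s t u. f (p + s *\<^sub>R v + t *\<^sub>R w + u *\<^sub>R z)))"

lemma vanishes_0:
  assumes "tpoly 0 n g"
  shows "vanishes n 0 (\<lambda>x. g (x $ 1) (x $ 2) (x $ 3)) p"
  unfolding vanishes_def
proof (intro allI)
  fix v w z :: "real ^ 3"
  show "tpoly 0 n (\<lambda>s t u. g ((p + s *\<^sub>R v + t *\<^sub>R w + u *\<^sub>R z) $ 1)
      ((p + s *\<^sub>R v + t *\<^sub>R w + u *\<^sub>R z) $ 2) ((p + s *\<^sub>R v + t *\<^sub>R w + u *\<^sub>R z) $ 3))"
    using tpoly_affine_substitution[OF assms, of "p $ 1" "v $ 1" "w $ 1" "z $ 1"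
        "p $ 2" "v $ 2" "w $ 2" "z $ 2" "p $ 3" "v $ 3" "w $ 3" "z $ 3"]
    by (simp add: mult.commute add.assoc)
qed

text \<open>Any three directions are linear combinations of the spanning frame, and linear
  substitution preserves the order. Hence a bound found along the lines of one joint can be used in
  the frame of another.\<close>

lemma vanishes_of_spanning_frame:
  assumes poly: "tpoly r n (\<lambda>s t u. f (p + s *\<^sub>R v + t *\<^sub>R w + u *\<^sub>R z))"
    and span: "\<And>x. \<exists>a b c. x = a *\<^sub>R v + b *\<^sub>R w + c *\<^sub>R z"
  shows "vanishes n r f p"
  unfolding vanishes_def
proof (intro allI)
  fix v' w' z'
  obtain a1 b1 c1 where 1: "v' = a1 *\<^sub>R v + b1 *\<^sub>R w + c1 *\<^sub>R z" using span by blast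
  obtain a2 b2 c2 where 2: "w' = a2 *\<^sub>R v + b2 *\<^sub>R w + c2 *\<^sub>R z" using span by blast
  obtain a3 b3 c3 where 3: "z' = a3 *\<^sub>R v + b3 *\<^sub>R w + c3 *\<^sub>R z" using span by blast
  have eq: "p + s *\<^sub>R v' + t *\<^sub>R w' + u *\<^sub>R z' = p + (a1 * s + a2 * t + a3 * u) *\<^sub>R v
      + (b1 * s + b2 * t + b3 * u) *\<^sub>R w + (c1 * s + c2 * t + c3 * u) *\<^sub>R z" for s t u
    by (simp add: 1 2 3 algebra_simps)
  show "tpoly r n (\<lambda>s t u. f (p + s *\<^sub>R v' + t *\<^sub>R w' + u *\<^sub>R z'))"
    unfolding eq by (rule tpoly_linear_substitution[OF poly])
qed

text \<open>Moving the base point along \<open>v\<close> only shifts the first variable, so the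
  points of \<open>X\<close> become points of the first axis.\<close>

lemma coeff_zero_of_vanishing_on_line:
  assumes X: "finite X" "n < card X * i" and le: "i + j + k \<le> n"
    and f: "\<And>s t u. f (p + s *\<^sub>R v + t *\<^sub>R w + u *\<^sub>R z) = trivariate n c s t u"
    and line: "\<And>q. q \<in> X \<Longrightarrow> \<exists>\<sigma>. q = p + \<sigma> *\<^sub>R v"
    and van: "\<And>q. q \<in> X \<Longrightarrow> vanishes n (i + j + k) f q"
  shows "c i j k = 0"
proof -
  obtain \<sigma> where \<sigma>: "\<And>q. q \<in> X \<Longrightarrow> q = p + \<sigma> q *\<^sub>R v" using line by metis
  have "inj_on \<sigma> X" by (rule inj_onI) (metis \<sigma>)
  then have card: "card (\<sigma> ` X) = card X" by (rule card_image)
  show ?thesis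
  proof (rule coeff_zero_of_vanishing_along_axis[of "\<sigma> ` X"])
    fix x assume "x \<in> \<sigma> ` X"
    then obtain q where q: "q \<in> X" "x = \<sigma> q" by blast
    have eq: "f (q + s *\<^sub>R v + t *\<^sub>R w + u *\<^sub>R z) = trivariate n c (x + s) t u" for s t u
      by (subst \<sigma>[OF q(1)]) (simp add: f[symmetric] q(2) scaleR_left_distrib add.assoc)
    have "tpoly (i + j + k) n (\<lambda>s t u. f (q + s *\<^sub>R v + t *\<^sub>R w + u *\<^sub>R z))"
      using van[OF q(1)] unfolding vanishes_def by blast
    then show "tpoly (i + j + k) n (\<lambda>s t u. trivariate n c (x + s) t u)" by (simp only: eq)
  qed (use X le card in auto)
qed

text \<open>Uniqueness of coefficients turns the order of vanishing into a statement about the given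
  array \<open>c\<close>.\<close>

lemma vanishes_coeffs:
  assumes "vanishes n r f p" "coeffs_between 0 n c"
    and f: "\<And>s t u. f (p + s *\<^sub>R v + t *\<^sub>R w + u *\<^sub>R z) = trivariate n c s t u"
  shows "coeffs_between r n c"
proof -
  have "tpoly r n (\<lambda>s t u. f (p + s *\<^sub>R v + t *\<^sub>R w + u *\<^sub>R z))"
    using assms(1) unfolding vanishes_def by blast
  then obtain d where d: "coeffs_between r n d" "trivariate n c = trivariate n d"
    unfolding tpoly_def by (auto simp: f)
  then have "c = d"
    using assms(2) by (intro trivariate_inject) (auto intro: coeffs_between_mono)
  then show ?thesis using d by simp
qed

section \<open>Raising the order of vanishing at all joints together\<close>

text \<open>The induction on \<open>r\<close> treats all points of \<open>S\<close> at once, because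
  the step at \<open>p\<close> uses order \<open>r\<close> at the other points on its lines. Only
  the coefficients of total degree \<open>r\<close> must be removed: \<open>box\<close> handles
  small exponents, and a large exponent forces too many zeros on the corresponding line.\<close>

lemma vanishes_to_all_orders:
  fixes l1 l2 l3 :: "real ^ 3 \<Rightarrow> 'l" and F :: "real ^ 3 \<Rightarrow> nat \<Rightarrow> nat \<Rightarrow> nat \<Rightarrow> real"
  assumes fin: "finite S"
    and span: "\<And>p x. p \<in> S \<Longrightarrow> \<exists>a b c. x = a *\<^sub>R v1 p + b *\<^sub>R v2 p + c *\<^sub>R v3 p"
    and line1: "\<And>p q. p \<in> S \<Longrightarrow> q \<in> S \<Longrightarrow> l1 q = l1 p \<Longrightarrow> \<exists>\<sigma>. q = p + \<sigma> *\<^sub>R v1 p"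
    and line2: "\<And>p q. p \<in> S \<Longrightarrow> q \<in> S \<Longrightarrow> l2 q = l2 p \<Longrightarrow> \<exists>\<sigma>. q = p + \<sigma> *\<^sub>R v2 p"
    and line3: "\<And>p q. p \<in> S \<Longrightarrow> q \<in> S \<Longrightarrow> l3 q = l3 p \<Longrightarrow> \<exists>\<sigma>. q = p + \<sigma> *\<^sub>R v3 p"
    and base: "\<And>p. p \<in> S \<Longrightarrow> vanishes n 0 f p"
    and F: "\<And>p. p \<in> S \<Longrightarrow> coeffs_between 0 n (F p)"
      "\<And>p s t u. p \<in> S \<Longrightarrow>
        f (p + s *\<^sub>R v1 p + t *\<^sub>R v2 p + u *\<^sub>R v3 p) = trivariate n (F p) s t u"
    and box: "\<And>p i j k. p \<in> S \<Longrightarrow> i \<le> n div card {q\<in>S. l1 q = l1 p} \<Longrightarrow>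
      j \<le> n div card {q\<in>S. l2 q = l2 p} \<Longrightarrow> k \<le> n div card {q\<in>S. l3 q = l3 p} \<Longrightarrow> F p i j k = 0"
    and p: "p \<in> S"
  shows "vanishes n r f p"
  using p
proof (induction r arbitrary: p)
  case 0
  then show ?case by (rule base)
next
  case (Suc r)
  have zero: "F p i j k = 0" if ijk: "i + j + k = r" "r \<le> n" for i j k
  proof -
    \<comment> \<open>A fibre contains \<open>p\<close> itself, so it is nonempty and exceeding the
      floor of the quotient gives the strict product inequality.\<close>
    have gt: "n < card {q\<in>S. l q = l p} * a" if "\<not> a \<le> n div card {q\<in>S. l q = l p}"
      for a and l :: "real ^ 3 \<Rightarrow> 'l"
    proof -
      have "card {q\<in>S. l q = l p} > 0" using Suc.prems fin by (auto simp: card_gt_0_iff)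
      with that show ?thesis by (simp add: not_le div_less_iff_less_mult mult.commute)
    qed
    consider "i \<le> n div card {q\<in>S. l1 q = l1 p}" "j \<le> n div card {q\<in>S. l2 q = l2 p}"
        "k \<le> n div card {q\<in>S. l3 q = l3 p}"
      | "\<not> i \<le> n div card {q\<in>S. l1 q = l1 p}" | "\<not> j \<le> n div card {q\<in>S. l2 q = l2 p}"
      | "\<not> k \<le> n div card {q\<in>S. l3 q = l3 p}" by blast
    then show ?thesis
    proof cases
      case 1
      then show ?thesis using box Suc.prems by blast
    next
      case 2
      have f: "f (p + s *\<^sub>R v1 p + t *\<^sub>R v2 p + u *\<^sub>R v3 p) = trivariate n (F p) s t u"
        for s t u
        by (rule F(2)[OF Suc.prems])
      have order: "i + j + k = r" using ijk by simp
      show ?thesis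
      proof (rule coeff_zero_of_vanishing_on_line[OF _ gt[OF 2] _ f])
        show "finite {q\<in>S. l1 q = l1 p}" using fin by simp
        show "\<exists>\<sigma>. q = p + \<sigma> *\<^sub>R v1 p" if "q \<in> {q\<in>S. l1 q = l1 p}" for q
          using that by (intro line1[OF Suc.prems]) auto
        show "vanishes n (i + j + k) f q" if "q \<in> {q\<in>S. l1 q = l1 p}" for q
          unfolding order using that by (intro Suc.IH) auto
        show "i + j + k \<le> n" using order ijk by simp
      qed
    next
      case 3
      \<comment> \<open>Rotating the variables brings the second line into the first slot, where the
        line lemma applies.\<close>
      have f: "f (p + s *\<^sub>R v2 p + t *\<^sub>R v3 p + u *\<^sub>R v1 p) = trivariate n (\<lambda>j k i. F p i j k) s t u"
        for s t u
        using F(2)[OF Suc.prems, of u s t] trivariate_rotate[of n "F p" s t u] by (simp add: add_ac)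
      have order: "j + k + i = r" using ijk by simp
      show ?thesis
      proof (rule coeff_zero_of_vanishing_on_line[OF _ gt[OF 3] _ f])
        show "finite {q\<in>S. l2 q = l2 p}" using fin by simp
        show "\<exists>\<sigma>. q = p + \<sigma> *\<^sub>R v2 p" if "q \<in> {q\<in>S. l2 q = l2 p}" for q
          using that by (intro line2[OF Suc.prems]) auto
        show "vanishes n (j + k + i) f q" if "q \<in> {q\<in>S. l2 q = l2 p}" for q
          unfolding order using that by (intro Suc.IH) auto
        show "j + k + i \<le> n" using order ijk by simp
      qed
    next
      case 4
      \<comment> \<open>Two rotations bring the third line into the first slot.\<close>
      have f: "f (p + s *\<^sub>R v3 p + t *\<^sub>R v1 p + u *\<^sub>R v2 p) = trivariate n (\<lambda>k i j. F p i j k) s t u"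
        for s t u
        using F(2)[OF Suc.prems, of t u s] trivariate_rotate[of n "\<lambda>j k i. F p i j k" s t u]
          trivariate_rotate[of n "F p" u s t]
        by (simp add: add_ac)
      have order: "k + i + j = r" using ijk by simp
      show ?thesis
      proof (rule coeff_zero_of_vanishing_on_line[OF _ gt[OF 4] _ f])
        show "finite {q\<in>S. l3 q = l3 p}" using fin by simp
        show "\<exists>\<sigma>. q = p + \<sigma> *\<^sub>R v3 p" if "q \<in> {q\<in>S. l3 q = l3 p}" for q
          using that by (intro line3[OF Suc.prems]) auto
        show "vanishes n (k + i + j) f q" if "q \<in> {q\<in>S. l3 q = l3 p}" for q
          unfolding order using that by (intro Suc.IH) auto
        show "k + i + j \<le> n" using order ijk by simp
      qed
    qed
  qed
  have "coeffs_between r n (F p)"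
    using vanishes_coeffs[OF Suc.IH[OF Suc.prems] F(1)[OF Suc.prems] F(2)[OF Suc.prems]] .
  \<comment> \<open>For \<open>r \<le> n\<close>, \<open>zero\<close> clears total degree
    \<open>r\<close>; for \<open>r > n\<close> the two degree bounds already exclude every
    coefficient.\<close>
  then have "coeffs_between (Suc r) n (F p)"
    using zero unfolding coeffs_between_def by (metis le_neq_implies_less less_eq_Suc_le)
  then have "tpoly (Suc r) n (\<lambda>s t u. f (p + s *\<^sub>R v1 p + t *\<^sub>R v2 p + u *\<^sub>R v3 p))"
    unfolding tpoly_def F(2)[OF Suc.prems] by blast
  then show ?case using span[OF Suc.prems] by (rule vanishes_of_spanning_frame)
qed

section \<open>Parameter counting\<close>

text \<open>The left side counts available monomials, the right side linear vanishing conditions.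
  With fewer conditions than monomials, some nonzero polynomial would satisfy them all and then
  vanish to every order.\<close>

lemma joints_parameter_count:
  fixes l1 l2 l3 :: "real ^ 3 \<Rightarrow> 'l"
  assumes fin: "finite S" and ne: "S \<noteq> {}"
    and span: "\<And>p x. p \<in> S \<Longrightarrow> \<exists>a b c. x = a *\<^sub>R v1 p + b *\<^sub>R v2 p + c *\<^sub>R v3 p"
    and line1: "\<And>p q. p \<in> S \<Longrightarrow> q \<in> S \<Longrightarrow> l1 q = l1 p \<Longrightarrow> \<exists>\<sigma>. q = p + \<sigma> *\<^sub>R v1 p"
    and line2: "\<And>p q. p \<in> S \<Longrightarrow> q \<in> S \<Longrightarrow> l2 q = l2 p \<Longrightarrow> \<exists>\<sigma>. q = p + \<sigma> *\<^sub>R v2 p"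
    and line3: "\<And>p q. p \<in> S \<Longrightarrow> q \<in> S \<Longrightarrow> l3 q = l3 p \<Longrightarrow> \<exists>\<sigma>. q = p + \<sigma> *\<^sub>R v3 p"
  shows "(n div 3 + 1) ^ 3 \<le> (\<Sum>p\<in>S. (n div card {q\<in>S. l1 q = l1 p} + 1) *
    ((n div card {q\<in>S. l2 q = l2 p} + 1) * (n div card {q\<in>S. l3 q = l3 p} + 1)))"
proof (rule ccontr)
  assume less: "\<not> ?thesis"
  \<comment> \<open>Three exponents of at most \<open>n div 3\<close> keep the total degree within
    \<open>n\<close>.\<close>
  define B where "B = {..n div 3} \<times> {..n div 3} \<times> {..n div 3}"
  define T where "T = (SIGMA p:S. {..n div card {q\<in>S. l1 q = l1 p}} \<times>
    {..n div card {q\<in>S. l2 q = l2 p}} \<times> {..n div card {q\<in>S. l3 q = l3 p}})"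
  have B: "finite B" "card B = (n div 3 + 1) ^ 3"
    by (auto simp: B_def card_cartesian_product power3_eq_cube)
  have T: "finite T" "card T = (\<Sum>p\<in>S. (n div card {q\<in>S. l1 q = l1 p} + 1) *
    ((n div card {q\<in>S. l2 q = l2 p} + 1) * (n div card {q\<in>S. l3 q = l3 p} + 1)))"
    using fin by (auto simp: T_def card_cartesian_product)
  have B_le: "i + j + k \<le> n" if "(i, j, k) \<in> B" for i j k
    using that by (auto simp: B_def)
  define \<mu> :: "nat \<times> nat \<times> nat \<Rightarrow> real ^ 3 \<Rightarrow> real" where
    "\<mu> = (\<lambda>(i, j, k) x. x $ 1 ^ i * x $ 2 ^ j * x $ 3 ^ k)"
  \<comment> \<open>Taylor coefficients \<open>e m p\<close> of each monomial \<open>m\<close> in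
    the frame at \<open>p\<close>; those of a combination of monomials depend linearly on its
    weights.\<close>
  have "\<exists>e. coeffs_between 0 n e \<and>
      (\<forall>s t u. \<mu> m (p + s *\<^sub>R v1 p + t *\<^sub>R v2 p + u *\<^sub>R v3 p) = trivariate n e s t u)"
    if "m \<in> B" for m p
  proof -
    obtain i j k where m: "m = (i, j, k)" by (cases m)
    have "vanishes n 0 (\<mu> m) p"
      unfolding \<mu>_def m prod.case
      by (rule vanishes_0) (use tpoly_monomial B_le that m in auto)
    then have "tpoly 0 n (\<lambda>s t u. \<mu> m (p + s *\<^sub>R v1 p + t *\<^sub>R v2 p + u *\<^sub>R v3 p))"
      unfolding vanishes_def by blast
    then show ?thesis unfolding tpoly_def fun_eq_iff by blast
  qed
  then obtain e where e: "\<And>m p. m \<in> B \<Longrightarrow> coeffs_between 0 n (e m p)"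
    "\<And>m p s t u. m \<in> B \<Longrightarrow>
      \<mu> m (p + s *\<^sub>R v1 p + t *\<^sub>R v2 p + u *\<^sub>R v3 p) = trivariate n (e m p) s t u"
    by metis
  have "card T < card B" using less B T by simp
  from homogeneous_system_nontrivial[OF T(1) B(1) this, of "\<lambda>(p, i, j, k) m. e m p i j k"]
  obtain c where c1: "\<exists>m\<in>B. c m \<noteq> 0"
    and "\<forall>\<tau>\<in>T. (\<Sum>m\<in>B. (case \<tau> of (p, i, j, k) \<Rightarrow> \<lambda>m. e m p i j k) m * c m) = 0" by blast
  then have c2: "(\<Sum>m\<in>B. c m * e m p i j k) = 0" if "(p, i, j, k) \<in> T" for p i j k
    using that by (auto simp: mult.commute dest!: bspec)
  define f where "f x = (\<Sum>m\<in>B. c m * \<mu> m x)" for x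
  define F where "F p i j k = (\<Sum>m\<in>B. c m * e m p i j k)" for p i j k
  have F1: "coeffs_between 0 n (F p)" for p
    unfolding coeffs_between_def
  proof (intro allI impI)
    fix i j k assume "F p i j k \<noteq> 0"
    then obtain m where "m \<in> B" "e m p i j k \<noteq> 0"
      unfolding F_def by (auto elim: sum.not_neutral_contains_not_neutral)
    then show "0 \<le> i + j + k \<and> i + j + k \<le> n" using e(1) unfolding coeffs_between_def by blast
  qed
  have F2: "f (p + s *\<^sub>R v1 p + t *\<^sub>R v2 p + u *\<^sub>R v3 p) = trivariate n (F p) s t u" for p s t u
  proof -
    have "f (p + s *\<^sub>R v1 p + t *\<^sub>R v2 p + u *\<^sub>R v3 p) = (\<Sum>m\<in>B. c m * trivariate n (e m p) s t u)"
      unfolding f_def by (intro sum.cong refl) (simp add: e(2))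
    also have "\<dots> = trivariate n (F p) s t u"
      unfolding F_def using B(1) by (rule trivariate_sum[symmetric])
    finally show ?thesis .
  qed
  \<comment> \<open>The weights padded by zeros to a full coefficient array, so that uniqueness of
    coefficients applies to \<open>f\<close>.\<close>
  define c' where "c' i j k = (if (i, j, k) \<in> B then c (i, j, k) else 0)" for i j k
  have c': "coeffs_between 0 n c'"
    using B_le by (auto simp: coeffs_between_def c'_def)
  have f_eq: "f x = trivariate n c' (x $ 1) (x $ 2) (x $ 3)" for x
  proof -
    have "trivariate n c' (x $ 1) (x $ 2) (x $ 3) =
        (\<Sum>(i, j, k)\<in>{..n} \<times> {..n} \<times> {..n}. c' i j k * x $ 1 ^ i * x $ 2 ^ j * x $ 3 ^ k)"
      by (simp add: trivariate_def sum.cartesian_product)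
    also have "\<dots> = (\<Sum>(i, j, k)\<in>B. c' i j k * x $ 1 ^ i * x $ 2 ^ j * x $ 3 ^ k)"
    proof (rule sum.mono_neutral_right)
      show "B \<subseteq> {..n} \<times> {..n} \<times> {..n}" by (auto simp: B_def)
    qed (auto simp: c'_def)
    also have "\<dots> = f x"
      unfolding f_def by (intro sum.cong refl) (auto simp: \<mu>_def c'_def)
    finally show ?thesis by simp
  qed
  obtain p where p: "p \<in> S" using ne by blast
  \<comment> \<open>Order \<open>n + 1\<close> exceeds the degree bound \<open>n\<close>, so all
    coefficients at a single joint vanish, and its frame reaches all of space.\<close>
  have "vanishes n (Suc n) f p"
  proof (rule vanishes_to_all_orders[OF fin span line1 line2 line3 _ F1 F2 _ p])
    show "vanishes n 0 f q" for q
      unfolding f_eq by (rule vanishes_0) (use c' in \<open>auto simp: tpoly_def\<close>)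
    show "F q i j k = 0" if "q \<in> S" "i \<le> n div card {r\<in>S. l1 r = l1 q}"
      "j \<le> n div card {r\<in>S. l2 r = l2 q}" "k \<le> n div card {r\<in>S. l3 r = l3 q}" for q i j k
      unfolding F_def by (rule c2) (use that in \<open>auto simp: T_def\<close>)
  qed
  then have "coeffs_between (Suc n) n (F p)" using F1 F2 by (rule vanishes_coeffs)
  then have "F p = (\<lambda>i j k. 0)"
    by (auto simp: fun_eq_iff intro: coeffs_betweenD)
  then have f0: "f (p + s *\<^sub>R v1 p + t *\<^sub>R v2 p + u *\<^sub>R v3 p) = 0" for s t u
    unfolding F2 by (simp add: trivariate_def)
  have "f x = 0" for x
  proof -
    obtain s t u where "x - p = s *\<^sub>R v1 p + t *\<^sub>R v2 p + u *\<^sub>R v3 p" using span[OF p] by blast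
    then have "x = p + s *\<^sub>R v1 p + t *\<^sub>R v2 p + u *\<^sub>R v3 p" by (simp add: algebra_simps)
    then show ?thesis using f0 by simp
  qed
  then have "trivariate n c' s t u = 0" for s t u
    using f_eq[of "vector [s, t, u]"] by simp
  then have "trivariate n c' = trivariate n (\<lambda>i j k. 0)"
    by (simp add: fun_eq_iff trivariate_def[of n "\<lambda>i j k. 0"])
  then have "c' = (\<lambda>i j k. 0)"
    by (intro trivariate_inject[OF c']) (auto simp: coeffs_between_def)
  then have "c m = 0" if "m \<in> B" for m
    using that by (cases m) (auto simp: c'_def fun_eq_iff split: if_splits)
  with c1 show False by blast
qed

section \<open>Discarding joints on poor lines\<close>

text \<open>Maximise \<open>card S - (\<Sum>i\<in>I. \<theta> i * card (l i ` S))\<close> over \<open>S \<subseteq> J\<close>: deleting a fibre of \<open>l i\<close> with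
  fewer than \<open>\<theta> i\<close> elements would increase this quantity.\<close>

lemma subset_with_rich_fibres:
  fixes l :: "'i \<Rightarrow> 'a \<Rightarrow> 'b" and \<theta> :: "'i \<Rightarrow> real"
  assumes fin: "finite J" "finite I" and \<theta>: "\<And>i. i \<in> I \<Longrightarrow> 0 \<le> \<theta> i"
    and pos: "(\<Sum>i\<in>I. \<theta> i * card (l i ` J)) < card J"
  obtains S where "S \<subseteq> J" "S \<noteq> {}"
    "\<And>i p. i \<in> I \<Longrightarrow> p \<in> S \<Longrightarrow> \<theta> i \<le> card {q\<in>S. l i q = l i p}"
proof -
  define \<Phi> where "\<Phi> S = card S - (\<Sum>i\<in>I. \<theta> i * card (l i ` S))" for S
  have fin': "finite (\<Phi> ` Pow J)" "\<Phi> ` Pow J \<noteq> {}" using fin by auto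
  obtain S where S: "S \<subseteq> J" "\<Phi> S = Max (\<Phi> ` Pow J)"
    using Max_in[OF fin'] by auto
  have max: "\<Phi> S' \<le> \<Phi> S" if "S' \<subseteq> J" for S'
    using fin' that by (simp add: S(2))
  have finS: "finite S" using S fin finite_subset by blast
  show thesis
  proof (rule that)
    show "S \<subseteq> J" by fact
    \<comment> \<open>\<Phi> is 0 at the empty set but positive at \<open>J\<close>.\<close>
    show "S \<noteq> {}" using max[of J] pos by (auto simp: \<Phi>_def)
    fix i p assume i: "i \<in> I" and p: "p \<in> S"
    let ?T = "{q\<in>S. l i q = l i p}"
    \<comment> \<open>Deleting the fibre removes the value \<open>l i p\<close> from the image of
      \<open>l i\<close> and enlarges no other image.\<close>
    have "(\<Sum>h\<in>I. \<theta> h * card (l h ` (S - ?T))) \<le>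
        (\<Sum>h\<in>I. \<theta> h * card (l h ` S) - (if h = i then \<theta> i else 0))"
    proof (rule sum_mono)
      fix h assume h: "h \<in> I"
      show "\<theta> h * card (l h ` (S - ?T)) \<le> \<theta> h * card (l h ` S) - (if h = i then \<theta> i else 0)"
      proof (cases "h = i")
        case True
        have "l i ` (S - ?T) \<subseteq> l i ` S - {l i p}" by auto
        then have "card (l i ` (S - ?T)) \<le> card (l i ` S - {l i p})"
          using finS by (intro card_mono) auto
        also have "\<dots> = card (l i ` S) - 1" using p finS by (simp add: card_Diff_singleton)
        finally have "card (l i ` (S - ?T)) \<le> card (l i ` S) - 1" .
        moreover have "card (l i ` S) > 0" using p finS by (auto simp: card_gt_0_iff)
        ultimately have "real (card (l i ` (S - ?T))) \<le> real (card (l i ` S)) - 1" by linarith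
        from mult_left_mono[OF this \<theta>[OF i]] show ?thesis by (simp add: True right_diff_distrib)
      next
        case False
        have "card (l h ` (S - ?T)) \<le> card (l h ` S)" using finS by (intro card_mono) auto
        then show ?thesis using False \<theta>[OF h] by (simp add: mult_left_mono)
      qed
    qed
    also have "\<dots> = (\<Sum>h\<in>I. \<theta> h * card (l h ` S)) - \<theta> i"
      using i fin by (simp add: sum_subtractf)
    finally have "(\<Sum>h\<in>I. \<theta> h * card (l h ` (S - ?T))) \<le> (\<Sum>h\<in>I. \<theta> h * card (l h ` S)) - \<theta> i" .
    moreover have "real (card (S - ?T)) = real (card S) - real (card ?T)"
      using finS by (subst card_Diff_subset) (auto simp: of_nat_diff card_mono)
    moreover have "\<Phi> (S - ?T) \<le> \<Phi> S" using S by (intro max) auto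
    ultimately show "\<theta> i \<le> card ?T" unfolding \<Phi>_def by linarith
  qed
qed

section \<open>Lines, directions and coplanarity\<close>

lemma line_direction:
  assumes "is_line l"
  obtains v where "\<And>p q. p \<in> l \<Longrightarrow> q \<in> l \<Longrightarrow> \<exists>\<sigma>. q = p + \<sigma> *\<^sub>R v"
proof -
  have "collinear l" using assms by (simp add: is_line_def collinear_aff_dim)
  then obtain v where v: "\<And>x y. x \<in> l \<Longrightarrow> y \<in> l \<Longrightarrow> \<exists>c. x - y = c *\<^sub>R v"
    unfolding collinear_def by blast
  show thesis
  proof (rule that)
    fix p q assume "p \<in> l" "q \<in> l"
    then obtain c where "q - p = c *\<^sub>R v" using v by blast
    then have "q = p + c *\<^sub>R v" by (simp add: algebra_simps)
    then show "\<exists>\<sigma>. q = p + \<sigma> *\<^sub>R v" by blast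
  qed
qed

text \<open>If one direction lay in the span of the other two, \<open>S\<close> would lie in a plane
  through \<open>p\<close>. So the three directions are independent, and in dimension three they
  span.\<close>

lemma spanning_of_not_coplanar:
  fixes p v1 v2 v3 :: "real ^ 3"
  assumes "\<not> coplanar S" and S: "S \<subseteq> (\<lambda>w. p + w) ` span {v1, v2, v3}"
  shows "\<exists>a b c. x = a *\<^sub>R v1 + b *\<^sub>R v2 + c *\<^sub>R v3"
proof -
  have small: "p + w \<in> affine hull {p, p + a, p + b}" if w: "w \<in> span {a, b}" for w a b
  proof -
    obtain s t where "w - s *\<^sub>R a - t *\<^sub>R b \<in> span {}"
      using w unfolding span_breakdown_eq by blast
    then have "w = s *\<^sub>R a + t *\<^sub>R b" by (simp add: algebra_simps)
    then have "p + w = (1 - s - t) *\<^sub>R p + s *\<^sub>R (p + a) + t *\<^sub>R (p + b)"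
      by (simp add: algebra_simps)
    then show ?thesis unfolding affine_hull_3 by force
  qed
  have "\<not> span {v1, v2, v3} \<subseteq> span {a, b}" for a b
  proof
    assume "span {v1, v2, v3} \<subseteq> span {a, b}"
    then have "S \<subseteq> affine hull {p, p + a, p + b}" using S small[of _ a b] by blast
    with assms(1) show False unfolding coplanar_def by blast
  qed
  from this[of v2 v3] this[of v1 v3] this[of v1 v2]
  have indep: "v1 \<notin> span {v2, v3}" "v2 \<notin> span {v1, v3}" "v3 \<notin> span {v1, v2}"
    using span_redundant[of v1 "{v2, v3}"] span_redundant[of v2 "{v1, v3}"]
      span_redundant[of v3 "{v1, v2}"] by (auto simp: insert_commute)
  then have "v1 \<noteq> v2" "v1 \<noteq> v3" "v2 \<noteq> v3"
    by (auto intro: span_base)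
  moreover have "independent {v1, v2, v3}"
    using indep calculation by (auto simp: dependent_def insert_Diff_if insert_commute)
  ultimately have "dim {v1, v2, v3} = 3" by (simp add: dim_eq_card_independent)
  then have "span {v1, v2, v3} = UNIV" by (subst dim_eq_full[symmetric]) simp
  then have "x \<in> span {v1, v2, v3}" by simp
  then obtain a b c where "x - a *\<^sub>R v1 - b *\<^sub>R v2 - c *\<^sub>R v3 \<in> span {}"
    unfolding span_breakdown_eq by blast
  then have "x = a *\<^sub>R v1 + b *\<^sub>R v2 + c *\<^sub>R v3" by (simp add: algebra_simps)
  then show ?thesis by blast
qed

section \<open>The bound on the number of joints\<close>

text \<open>Stated for finite sets of joints because finiteness of \<open>joints\<close> is itself
  derived from this bound. Squaring keeps the inequality within the natural numbers.\<close>

lemma card_joints_subset_bound: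
  assumes fin: "finite L1" "finite L2" "finite L3"
    and lines: "\<forall>l\<in>L1. is_line l" "\<forall>l\<in>L2. is_line l" "\<forall>l\<in>L3. is_line l"
    and J: "finite J" "J \<subseteq> joints L1 L2 L3"
  shows "card J ^ 2 \<le> 216 ^ 2 * (card L1 * card L2 * card L3)"
proof (cases "J = {}")
  case False
  define N where "N = card J"
  have N: "N > 0" using False J by (simp add: N_def card_gt_0_iff)
  have "\<forall>p\<in>J. \<exists>l1 l2 l3. l1 \<in> L1 \<and> l2 \<in> L2 \<and> l3 \<in> L3 \<and> p \<in> l1 \<and> p \<in> l2 \<and> p \<in> l3 \<and>
      \<not> coplanar (l1 \<union> l2 \<union> l3)"
    using J(2) unfolding joints_def by blast
  then obtain l1 l2 l3 where L: "\<And>p. p \<in> J \<Longrightarrow> l1 p \<in> L1" "\<And>p. p \<in> J \<Longrightarrow> l2 p \<in> L2"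
      "\<And>p. p \<in> J \<Longrightarrow> l3 p \<in> L3"
    and mem: "\<And>p. p \<in> J \<Longrightarrow> p \<in> l1 p" "\<And>p. p \<in> J \<Longrightarrow> p \<in> l2 p" "\<And>p. p \<in> J \<Longrightarrow> p \<in> l3 p"
    and ncop: "\<And>p. p \<in> J \<Longrightarrow> \<not> coplanar (l1 p \<union> l2 p \<union> l3 p)"
    unfolding bchoice_iff by blast
  have "\<forall>l. is_line l \<longrightarrow> (\<exists>v. \<forall>p q. p \<in> l \<longrightarrow> q \<in> l \<longrightarrow> (\<exists>\<sigma>. q = p + \<sigma> *\<^sub>R v))"
    using line_direction by metis
  then obtain d where d: "\<And>l p q. is_line l \<Longrightarrow> p \<in> l \<Longrightarrow> q \<in> l \<Longrightarrow> \<exists>\<sigma>. q = p + \<sigma> *\<^sub>R d l"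
    by metis
  have span: "\<exists>a b c. x = a *\<^sub>R d (l1 p) + b *\<^sub>R d (l2 p) + c *\<^sub>R d (l3 p)" if p: "p \<in> J" for p x
  proof (rule spanning_of_not_coplanar[OF ncop[OF p], of p], rule subsetI)
    fix q assume "q \<in> l1 p \<union> l2 p \<union> l3 p"
    then obtain l where l: "l \<in> {l1 p, l2 p, l3 p}" "q \<in> l" by blast
    then have "is_line l" "p \<in> l" using L mem lines p by auto
    then obtain \<sigma> where \<sigma>: "q = p + \<sigma> *\<^sub>R d l" using d l(2) by blast
    have "\<sigma> *\<^sub>R d l \<in> span {d (l1 p), d (l2 p), d (l3 p)}"
      using l(1) by (intro span_mul span_base) auto
    then show "q \<in> (+) p ` span {d (l1 p), d (l2 p), d (l3 p)}" using \<sigma> by blast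
  qed
  have a: "card L1 > 0" "card L2 > 0" "card L3 > 0"
    using fin L False by (auto simp: card_gt_0_iff)
  define l where "l i = (if i = 0 then l1 else if i = 1 then l2 else l3)" for i :: nat
  define A where "A i = (if i = 0 then L1 else if i = 1 then L2 else L3)" for i :: nat
  \<comment> \<open>With the factor 6, each of the three families costs at most
    \<open>N / 6\<close>, in total \<open>N / 2 < N\<close>.\<close>
  define \<theta> where "\<theta> i = real N / (6 * card (A i))" for i
  have A: "card (A i) > 0" "finite (A i)" "l i ` J \<subseteq> A i" for i
    using a fin L by (auto simp: A_def l_def)
  have "(\<Sum>i<3. \<theta> i * card (l i ` J)) \<le> (\<Sum>i<(3::nat). real N / 6)"
  proof (rule sum_mono)
    fix i
    have "\<theta> i * card (l i ` J) \<le> \<theta> i * card (A i)"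
      using A[of i] by (intro mult_left_mono) (auto simp: \<theta>_def card_mono)
    then show "\<theta> i * card (l i ` J) \<le> real N / 6" using A(1)[of i] by (simp add: \<theta>_def)
  qed
  also have "\<dots> < card J" using N by (simp add: N_def)
  finally obtain S where S: "S \<subseteq> J" "S \<noteq> {}"
    and rich: "\<And>i p. i \<in> {..<3} \<Longrightarrow> p \<in> S \<Longrightarrow> \<theta> i \<le> card {q\<in>S. l i q = l i p}"
    using J(1) by (elim subset_with_rich_fibres[rotated -1]) (auto simp: \<theta>_def)
  have finS: "finite S" using S J finite_subset by blast
  \<comment> \<open>The quotient \<open>N / ?m\<close> is at least 1 and at most
    \<open>6 * card (A i)\<close>, so the added 1 at most doubles the bound.\<close>
  have fibre: "real (N div card {q\<in>S. l i q = l i p} + 1) \<le> 12 * card (A i)"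
    if "i < 3" "p \<in> S" for i p
  proof -
    let ?m = "card {q\<in>S. l i q = l i p}"
    have m: "?m > 0" using finS that by (auto simp: card_gt_0_iff)
    have "?m \<le> N" unfolding N_def using J S by (intro card_mono) auto
    then have "1 \<le> real N / ?m" using m by (simp add: field_simps)
    moreover have "real (N div ?m) \<le> real N / ?m" by (rule of_nat_div_le_of_nat)
    moreover have "real N / ?m \<le> 6 * card (A i)"
      using rich[of i p] that m A(1)[of i] by (simp add: \<theta>_def field_simps)
    ultimately show ?thesis by simp
  qed
  \<comment> \<open>The degree is taken to be \<open>N\<close>, the size of the whole set
    \<open>J\<close>, while the conditions are imposed only at points of \<open>S\<close>.\<close>
  have "(N div 3 + 1) ^ 3 \<le> (\<Sum>p\<in>S. (N div card {q\<in>S. l1 q = l1 p} + 1) *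
    ((N div card {q\<in>S. l2 q = l2 p} + 1) * (N div card {q\<in>S. l3 q = l3 p} + 1)))"
  proof (rule joints_parameter_count[OF finS S(2)])
    fix p q assume pq: "p \<in> S" "q \<in> S"
    then have J': "p \<in> J" "q \<in> J" using S by auto
    show "\<exists>\<sigma>. q = p + \<sigma> *\<^sub>R d (l1 p)" if "l1 q = l1 p"
      using that J' L(1) lines(1) mem(1) by (intro d) auto
    show "\<exists>\<sigma>. q = p + \<sigma> *\<^sub>R d (l2 p)" if "l2 q = l2 p"
      using that J' L(2) lines(2) mem(2) by (intro d) auto
    show "\<exists>\<sigma>. q = p + \<sigma> *\<^sub>R d (l3 p)" if "l3 q = l3 p"
      using that J' L(3) lines(3) mem(3) by (intro d) auto
  qed (use span S in blast)
  then have "real ((N div 3 + 1) ^ 3) \<le> (\<Sum>p\<in>S. real (N div card {q\<in>S. l1 q = l1 p} + 1) *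
    (real (N div card {q\<in>S. l2 q = l2 p} + 1) * real (N div card {q\<in>S. l3 q = l3 p} + 1)))"
    unfolding of_nat_mult[symmetric] of_nat_sum[symmetric] of_nat_le_iff .
  also have "\<dots> \<le> (\<Sum>p\<in>S. (12 * real (card L1)) * ((12 * real (card L2)) * (12 * real (card L3))))"
    using fibre[of 0] fibre[of 1] fibre[of 2]
    by (intro sum_mono mult_mono) (auto simp: l_def A_def)
  also have "\<dots> = card S * (1728 * real (card L1 * card L2 * card L3))" by simp
  also have "\<dots> \<le> N * (1728 * real (card L1 * card L2 * card L3))"
    unfolding N_def using card_mono[OF J(1) S(1)] by (intro mult_right_mono) auto
  finally have "real ((N div 3 + 1) ^ 3) \<le> N * (1728 * real (card L1 * card L2 * card L3))" .
  moreover have "(real N / 3) ^ 3 \<le> real ((N div 3 + 1) ^ 3)"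
  proof -
    have "N \<le> 3 * (N div 3 + 1)" by simp
    then have "real N / 3 \<le> real (N div 3 + 1)" by linarith
    then have "(real N / 3) ^ 3 \<le> real (N div 3 + 1) ^ 3" by (intro power_mono) auto
    then show ?thesis by simp
  qed
  \<comment> \<open>Constants: \<open>12 ^ 3 = 1728\<close> from the fibres and
    \<open>3 ^ 3 = 27\<close> from the cube of monomials, with
    \<open>27 * 1728 = 216 ^ 2\<close>.\<close>
  ultimately have "real N * real N ^ 2 \<le> real N * (216 ^ 2 * real (card L1 * card L2 * card L3))"
    by (simp add: power_divide power3_eq_cube power2_eq_square)
  then have "real (N ^ 2) \<le> real (216 ^ 2 * (card L1 * card L2 * card L3))"
    using N by simp
  then show ?thesis unfolding of_nat_le_iff N_def .
qed simp

text \<open>The constant 216 is the square root of the factor in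
  \<open>card_joints_subset_bound\<close> and serves every \<epsilon>: nonempty sets have
  cardinality at least 1, so adding \<epsilon> to the exponent 1/2 only enlarges the right
  side.\<close>

theorem theorem4p1:
  fixes \<epsilon> :: real
  assumes "\<epsilon> > 0"
  shows "\<exists>C::real. \<forall>L1 L2 L3 :: (real ^ 3) set set.
           finite L1 \<and> L1 \<noteq> {} \<and> (\<forall>l\<in>L1. is_line l) \<and>
           finite L2 \<and> L2 \<noteq> {} \<and> (\<forall>l\<in>L2. is_line l) \<and>
           finite L3 \<and> L3 \<noteq> {} \<and> (\<forall>l\<in>L3. is_line l) \<longrightarrow>
             finite (joints L1 L2 L3) \<and>
             real (card (joints L1 L2 L3)) \<le>
               C * real (card L1) powr (1/2 + \<epsilon>) * real (card L2) powr (1/2 + \<epsilon>)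
                 * real (card L3) powr (1/2 + \<epsilon>) \<and>
             (\<forall>N::nat. card L1 = N \<and> card L2 = N \<and> card L3 = N \<longrightarrow>
                real (card (joints L1 L2 L3)) \<le> C * real N powr (3/2 + 3 * \<epsilon>))"
proof (intro exI[of _ 216] allI impI)
  fix L1 L2 L3 :: "(real ^ 3) set set"
  assume asm: "finite L1 \<and> L1 \<noteq> {} \<and> (\<forall>l\<in>L1. is_line l) \<and>
    finite L2 \<and> L2 \<noteq> {} \<and> (\<forall>l\<in>L2. is_line l) \<and> finite L3 \<and> L3 \<noteq> {} \<and> (\<forall>l\<in>L3. is_line l)"
  let ?P = "card L1 * card L2 * card L3"
  have sq: "card J ^ 2 \<le> 216 ^ 2 * ?P" if "J \<subseteq> joints L1 L2 L3" "finite J" for J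
    using asm that by (intro card_joints_subset_bound) auto
  \<comment> \<open>A uniform bound on all finite subsets gives finiteness; it follows from
    \<open>sq\<close> because a natural number is at most its square.\<close>
  have "finite (joints L1 L2 L3) \<and> card (joints L1 L2 L3) \<le> 216 ^ 2 * ?P"
  proof (rule finite_if_finite_subsets_card_bdd)
    fix J assume "J \<subseteq> joints L1 L2 L3" "finite J"
    then show "card J \<le> 216 ^ 2 * ?P"
      using sq[of J] self_le_power[of "card J" 2] by (cases "card J = 0") auto
  qed
  then have fin: "finite (joints L1 L2 L3)" ..
  have half: "sqrt (real (card L)) \<le> real (card L) powr (1/2 + \<epsilon>)" if "finite L" "L \<noteq> {}" for L :: "(real ^ 3) set set"
  proof -
    have "1 \<le> card L" using that by (simp add: Suc_le_eq card_gt_0_iff)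
    then show ?thesis using assms by (simp add: powr_half_sqrt[symmetric] powr_mono)
  qed
  have "real (card (joints L1 L2 L3)) ^ 2 \<le> 216 ^ 2 * real ?P"
    using of_nat_mono[OF sq[OF order_refl fin], where 'a = real] by simp
  then have "real (card (joints L1 L2 L3)) \<le> sqrt (216 ^ 2 * real ?P)"
    by (rule real_le_rsqrt)
  also have "\<dots> = 216 * sqrt (card L1) * sqrt (card L2) * sqrt (card L3)"
    by (simp add: real_sqrt_mult)
  also have "\<dots> \<le> 216 * real (card L1) powr (1/2 + \<epsilon>) * real (card L2) powr (1/2 + \<epsilon>)
      * real (card L3) powr (1/2 + \<epsilon>)"
    using asm by (intro mult_mono half) auto
  finally have bound: "real (card (joints L1 L2 L3)) \<le> 216 * real (card L1) powr (1/2 + \<epsilon>)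
      * real (card L2) powr (1/2 + \<epsilon>) * real (card L3) powr (1/2 + \<epsilon>)" .
  have "real (card (joints L1 L2 L3)) \<le> 216 * real N powr (3/2 + 3 * \<epsilon>)"
    if "card L1 = N \<and> card L2 = N \<and> card L3 = N" for N
  proof -
    have "real N powr (1/2 + \<epsilon>) * real N powr (1/2 + \<epsilon>) * real N powr (1/2 + \<epsilon>) = real N powr (3/2 + 3 * \<epsilon>)"
      by (simp add: powr_add[symmetric])
    then show ?thesis using bound that by (simp add: mult.assoc)
  qed
  with fin bound show "finite (joints L1 L2 L3) \<and>
      real (card (joints L1 L2 L3)) \<le> 216 * real (card L1) powr (1/2 + \<epsilon>)
        * real (card L2) powr (1/2 + \<epsilon>) * real (card L3) powr (1/2 + \<epsilon>) \<and>
      (\<forall>N::nat. card L1 = N \<and> card L2 = N \<and> card L3 = N \<longrightarrow>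
        real (card (joints L1 L2 L3)) \<le> 216 * real N powr (3/2 + 3 * \<epsilon>))" by blast
qed

end
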